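(* Assume that $A\cap \operatorname{dom} f\neq\emptyset$. Then for each $(x^{*},s)\in X^{*}\times\mathbb{R}$ the following two assertions are equivalent: (1) for every $x\in C$ such that $f_i(x)\le 0$ for all $i\in I$, one has $f(x)-\langle x^{*},x\rangle\ge s$; (2) $(x^{*},-s)\in\overline{\operatorname{epi} f^{*}+K}$.
   Context: $X$ is a real locally convex Hausdorff topological vector space with topological dual $X^{*}$. $X^{*}$ carries the weak$^{*}$ topology, $X^{*}\times\mathbb{R}$ the corresponding product topology, and $\overline{E}$ denotes closure of $E$ in these topologies. $\Gamma(X)$ is the set of proper (never $-\infty$, not identically $+\infty$) lower semicontinuous convex functions $X\to\mathbb{R}\cup\{+\infty\}$. Data: $I$ is an arbitrary (possibly infinite) index set, $C\subset X$ is a nonempty closed convex set, $f_i\in\Gamma(X)$ for each $i\in I$, and $f\in\Gamma(X)$. The solution set of the system $\{f_i(x)\le 0,\ i\in I;\ x\in C\}$ is $A:=\{x\in C: f_i(x)\le 0\ \forall i\in I\}$. Notation: $\operatorname{dom} h=\{h<+\infty\}$; $\operatorname{epi} h=\{(x,r): r\in\mathbb{R},\ h(x)\le r\}$; $h^{*}(x^{*})=\sup_{x\in X}(\langle x^{*},x\rangle-h(x))$ is the Fenchel conjugate; $\delta_D$ is the indicator of $D$ ($0$ on $D$, $+\infty$ elsewhere); $\operatorname{cone} D$ is the convex cone generated by $D\cup\{0\}$. The characteristic cone is $$K:=\operatorname{cone}\Big(\operatorname{epi}\delta_C^{*}\cup\bigcup_{i\in I}\operatorname{epi} f_i^{*}\Big)\subset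 X^{*}\times\mathbb{R}.$$ *)

theory Defs
  imports "HOL-Analysis.Analysis"
begin

section \<open>Locally convex Hausdorff spaces\<close>

class locally_convex_space = real_vector + t2_space + topological_ab_group_add +
  assumes tendsto_scaleR_nhds:
      "LIM p (nhds (c::real) \<times>\<^sub>F nhds x). fst p *\<^sub>R snd p :> nhds (c *\<^sub>R x)"
    and convex_nhds_base_raw:
      "open U \<Longrightarrow> 0 \<in> U \<Longrightarrow> \<exists>V. open V \<and> 0 \<in> V \<and> V \<subseteq> U \<and>
         (\<forall>x\<in>V. \<forall>y\<in>V. \<forall>u\<ge>0. \<forall>v\<ge>0. u + v = 1 \<longrightarrow> u *\<^sub>R x + v *\<^sub>R y \<in> V)"

text \<open>The constant \<open>convex\<close> is not available inside a class specification, so the axiom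
  above spells it out.\<close>

lemma convex_nhds_base:
  fixes U :: "'a::locally_convex_space set"
  assumes "open U" "0 \<in> U"
  shows "\<exists>V. open V \<and> convex V \<and> 0 \<in> V \<and> V \<subseteq> U"
  using convex_nhds_base_raw[OF assms] unfolding convex_def by blast

instance real_normed_vector \<subseteq> locally_convex_space
proof
  fix c :: real and x :: 'a
  have "((\<lambda>p. fst p *\<^sub>R snd p) \<longlongrightarrow> c *\<^sub>R x) (nhds c \<times>\<^sub>F nhds x)"
    by (rule tendsto_scaleR) (rule filterlim_fst, rule filterlim_snd)
  then show "LIM p (nhds c \<times>\<^sub>F nhds x). fst p *\<^sub>R snd p :> nhds (c *\<^sub>R x)" .
next
  fix U :: "'a set"
  assume "open U" "0 \<in> U"
  then obtain e where "e > 0" "ball 0 e \<subseteq> U"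
    by (meson openE)
  moreover from \<open>e > 0\<close> have "open (ball (0::'a) e)" "0 \<in> ball (0::'a) e" "convex (ball (0::'a) e)"
    by auto
  ultimately show "\<exists>V. open V \<and> 0 \<in> V \<and> V \<subseteq> U \<and>
      (\<forall>x\<in>V. \<forall>y\<in>V. \<forall>u\<ge>0. \<forall>v\<ge>0. u + v = 1 \<longrightarrow> u *\<^sub>R x + v *\<^sub>R y \<in> V)"
    unfolding convex_def by blast
qed

section \<open>The topological dual with the weak-star topology\<close>

typedef (overloaded) 'a top_dual =
    "{\<phi> :: 'a::locally_convex_space \<Rightarrow> real. linear \<phi> \<and> continuous_on UNIV \<phi>}"
  morphisms dual_apply Top_Dual
  by (rule exI[of _ "\<lambda>_. 0"]) (auto simp: linear_iff)

setup_lifting type_definition_top_dual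

instantiation top_dual :: (locally_convex_space) real_vector
begin

lift_definition zero_top_dual :: "'a top_dual" is "\<lambda>_. 0"
  by (auto simp: linear_iff)

lift_definition plus_top_dual :: "'a top_dual \<Rightarrow> 'a top_dual \<Rightarrow> 'a top_dual"
  is "\<lambda>\<phi> \<psi> x. \<phi> x + \<psi> x"
  by (auto simp: linear_iff algebra_simps intro!: continuous_intros)

lift_definition minus_top_dual :: "'a top_dual \<Rightarrow> 'a top_dual \<Rightarrow> 'a top_dual"
  is "\<lambda>\<phi> \<psi> x. \<phi> x - \<psi> x"
  by (auto simp: linear_iff algebra_simps intro!: continuous_intros)

lift_definition uminus_top_dual :: "'a top_dual \<Rightarrow> 'a top_dual"
  is "\<lambda>\<phi> x. - \<phi> x"
  by (auto simp: linear_iff algebra_simps intro!: continuous_intros)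

lift_definition scaleR_top_dual :: "real \<Rightarrow> 'a top_dual \<Rightarrow> 'a top_dual"
  is "\<lambda>c \<phi> x. c * \<phi> x"
  by (auto simp: linear_iff algebra_simps intro!: continuous_intros)

instance
  by standard (transfer; auto simp: algebra_simps)+

end

text \<open>The weak-star topology: the coarsest topology making every evaluation
  \<open>\<phi> \<mapsto> \<phi> x\<close> continuous.\<close>

instantiation top_dual :: (locally_convex_space) topological_space
begin

definition open_top_dual :: "'a top_dual set \<Rightarrow> bool" where
  "open_top_dual = generate_topology {(\<lambda>\<phi>. dual_apply \<phi> x) -` W |x W. open W}"

instance
  by standard (auto simp: open_top_dual_def intro: generate_topology.intros)

end

section \<open>Convex analysis of extended-real-valued functions\<close>

definition edom :: "('a \<Rightarrow> ereal) \<Rightarrow> 'a set" where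
  "edom h = {x. h x < \<infinity>}"

definition epi :: "('a \<Rightarrow> ereal) \<Rightarrow> ('a \<times> real) set" where
  "epi h = {(x, r). h x \<le> ereal r}"

definition proper_fun :: "('a \<Rightarrow> ereal) \<Rightarrow> bool" where
  "proper_fun h \<longleftrightarrow> (\<forall>x. h x \<noteq> -\<infinity>) \<and> (\<exists>x. h x \<noteq> \<infinity>)"

definition lsc_fun :: "('a::topological_space \<Rightarrow> ereal) \<Rightarrow> bool" where
  "lsc_fun h \<longleftrightarrow> (\<forall>x a. a < h x \<longrightarrow> eventually (\<lambda>y. a < h y) (nhds x))"

text \<open>Only used for functions that never take the value \<open>-\<infinity>\<close>, so that the
  right-hand side of the Jensen inequality never involves \<open>\<infinity> - \<infinity>\<close>.\<close>

definition econvex :: "('a::real_vector \<Rightarrow> ereal) \<Rightarrow> bool" where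
  "econvex h \<longleftrightarrow> (\<forall>x y t. 0 < t \<and> t < 1 \<longrightarrow>
     h ((1 - t) *\<^sub>R x + t *\<^sub>R y) \<le> ereal (1 - t) * h x + ereal t * h y)"

definition Gamma_fun :: "('a::locally_convex_space \<Rightarrow> ereal) set" where
  "Gamma_fun = {h. proper_fun h \<and> lsc_fun h \<and> econvex h}"

definition indicator_fun :: "'a set \<Rightarrow> 'a \<Rightarrow> ereal" where
  "indicator_fun D x = (if x \<in> D then 0 else \<infinity>)"

definition conjugate :: "('a::locally_convex_space \<Rightarrow> ereal) \<Rightarrow> 'a top_dual \<Rightarrow> ereal" where
  "conjugate h xs = (SUP x. ereal (dual_apply xs x) - h x)"

section \<open>Convex systems\<close>

definition solution_set :: "'a set \<Rightarrow> 'i set \<Rightarrow> ('i \<Rightarrow> 'a \<Rightarrow> ereal) \<Rightarrow> 'a set" where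
  "solution_set C I g = {x \<in> C. \<forall>i\<in>I. g i x \<le> 0}"

definition char_cone ::
    "'a::locally_convex_space set \<Rightarrow> 'i set \<Rightarrow> ('i \<Rightarrow> 'a \<Rightarrow> ereal) \<Rightarrow> ('a top_dual \<times> real) set"
  where
  "char_cone C I g = convex_cone hull
     (insert 0 (epi (conjugate (indicator_fun C)) \<union> (\<Union>i\<in>I. epi (conjugate (g i)))))"

end

theory Submission
  imports Defs
begin

text \<open>A pair \<open>(\<phi>, r)\<close> lies in the epigraph of \<open>h\<^sup>*\<close> iff the affine function \<open>\<phi> - r\<close> is a
minorant of \<open>h\<close>. So a member of the characteristic cone is an affine function that the system
makes nonpositive on its solution set \<open>A\<close>, a member of \<open>E = epi f\<^sup>* + K\<close> is an affine function
that lies below \<open>f\<close> on \<open>A\<close>. At each single point of \<open>A\<close> this last property is a weak-star closed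
condition on \<open>(\<phi>, r)\<close>, so it passes to the closure of \<open>E\<close>.
This is the passage from the dual condition to the inequality.

For the converse, let \<open>(\<xi>, -s)\<close> lie outside the closure of the convex set \<open>E\<close>. Because
weak-star continuous functionals are evaluations, a separating functional is a point
\<open>(x, b)\<close> of \<open>X \<times> \<real>\<close>, and
\<open>\<phi> x - b r + 1 \<le> \<xi> x + b s\<close> for all \<open>(\<phi>, r) \<in> E\<close> (lemma \<open>weak_star_separation\<close>).
As \<open>r\<close> may grow, \<open>b \<ge> 0\<close>. The separation may be vertical, \<open>b = 0\<close>; this is where
\<open>A \<inter> dom f \<noteq> {}\<close> is used. Every point \<open>a\<close> of \<open>A \<inter> dom f\<close> gives the valid inequality
\<open>\<phi> a - r \<le> f a\<close> on \<open>E\<close>, and a small multiple of it can be added without using up the gap \<open>1\<close>.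
After division by the new, positive coefficient of \<open>r\<close> there is a point \<open>z\<close> and a number
\<open>m < \<xi> z + s\<close> with \<open>\<phi> z - r \<le> m\<close> on \<open>E\<close>. Since \<open>K\<close> is a cone, \<open>\<phi> z - r \<le> 0\<close> on \<open>K\<close>. The
Fenchel-Moreau theorem, applied to \<open>\<delta>\<^sub>C\<close>, to each constraint and to \<open>f\<close>, turns these
bounds into \<open>z \<in> C\<close>, \<open>g\<^sub>i z \<le> 0\<close> and \<open>f z \<le> m < \<xi> z + s\<close>, so that the inequality
fails at \<open>z \<in> A\<close>.

Both separations, the one in the weak-star dual and the one behind the Fenchel-Moreau theorem,
are instances of one algebraic statement, \<open>convex_separation_absorbing\<close>: a convex absorbing set
and a convex set disjoint from it are separated by a linear functional. It is obtained from the
fact that a minimal sublinear functional is linear. Continuity is recovered afterwards from the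
bound on the absorbing set.\<close>

section \<open>Sublinear functionals\<close>

definition sublinear :: "('a::real_vector \<Rightarrow> real) \<Rightarrow> bool" where
  "sublinear p \<longleftrightarrow> (\<forall>x y. p (x + y) \<le> p x + p y) \<and> (\<forall>c x. c > 0 \<longrightarrow> p (c *\<^sub>R x) = c * p x)"

lemma sublinearI:
  assumes "\<And>x y. p (x + y) \<le> p x + p y"
    and "\<And>c x. c > 0 \<Longrightarrow> p (c *\<^sub>R x) \<le> c * p x"
  shows "sublinear p"
  unfolding sublinear_def
proof (intro conjI allI impI)
  fix c :: real and x assume c: "c > 0"
  have "p x = p (inverse c *\<^sub>R (c *\<^sub>R x))" using c by simp
  also have "\<dots> \<le> inverse c * p (c *\<^sub>R x)" using c by (intro assms(2)) simp
  finally have "c * p x \<le> p (c *\<^sub>R x)" using c by (simp add: field_simps)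
  then show "p (c *\<^sub>R x) = c * p x" using assms(2)[OF c, of x] by linarith
qed (rule assms(1))

lemma sublinear_add: "sublinear p \<Longrightarrow> p (x + y) \<le> p x + p y"
  and sublinear_scaleR: "sublinear p \<Longrightarrow> c > 0 \<Longrightarrow> p (c *\<^sub>R x) = c * p x"
  by (auto simp: sublinear_def)

lemma sublinear_zero: "sublinear p \<Longrightarrow> p 0 = 0"
  using sublinear_scaleR[of p 2 0] by simp

lemma sublinear_uminus_ge: "sublinear p \<Longrightarrow> - p (- x) \<le> p x"
  using sublinear_add[of p x "- x"] sublinear_zero[of p] by simp

text \<open>The bound \<open>q (- d) \<le> - c\<close> can be imposed on a sublinear minorant of \<open>p\<close> as soon as
\<open>c \<le> p d\<close> on \<open>D\<close>: the functional \<open>q x = inf {p (x + t d) - t c | t \<ge> 0, d \<in> D}\<close>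
has it, by the choice \<open>t = 1\<close>. The bound \<open>c \<le> p d\<close> keeps the infimum finite, and the convexity of \<open>D\<close>
gives subadditivity. For a singleton \<open>D\<close> this yields the linearity of minimal sublinear
functionals, and for a general \<open>D\<close> the separation theorem.\<close>

lemma sublinear_minorant_below:
  fixes p :: "'a::real_vector \<Rightarrow> real"
  assumes p: "sublinear p" and D: "convex D" "D \<noteq> {}" and c: "\<And>d. d \<in> D \<Longrightarrow> c \<le> p d"
  obtains q where "sublinear q" "\<And>x. q x \<le> p x" "\<And>d. d \<in> D \<Longrightarrow> q (- d) \<le> - c"
proof -
  define h where "h x z = p (x + fst z *\<^sub>R snd z) - fst z * c" for x and z :: "real \<times> 'a"
  define Z where "Z = {0::real..} \<times> D"
  define q where "q x = (INF z\<in>Z. h x z)" for x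
  have Z: "Z \<noteq> {}" using D by (auto simp: Z_def)
  have lower: "- p (- x) \<le> h x z" if zZ: "z \<in> Z" for x z
  proof -
    obtain t d where z: "z = (t, d)" "t \<ge> 0" "d \<in> D" using zZ by (auto simp: Z_def)
    have "t * c \<le> p (t *\<^sub>R d)"
      using z c[of d] sublinear_scaleR[OF p, of t d] sublinear_zero[OF p]
      by (cases "t = 0") auto
    also have "\<dots> \<le> p (x + t *\<^sub>R d) + p (- x)"
      using sublinear_add[OF p, of "x + t *\<^sub>R d" "- x"] by simp
    finally show ?thesis by (simp add: h_def z)
  qed
  have bdd: "bdd_below (h x ` Z)" for x by (rule bdd_belowI2[OF lower])
  have le: "q x \<le> h x z" if "z \<in> Z" for x z
    unfolding q_def by (rule cINF_lower[OF bdd that])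
  have ge: "m \<le> q x" if "\<And>z. z \<in> Z \<Longrightarrow> m \<le> h x z" for m x
    unfolding q_def by (rule cINF_greatest[OF Z that])
  have add: "q (x + y) \<le> h x z + h y w" if zw: "z \<in> Z" "w \<in> Z" for x y z w
  proof -
    obtain t d where z: "z = (t, d)" "t \<ge> 0" "d \<in> D" using zw by (auto simp: Z_def)
    obtain u e where w: "w = (u, e)" "u \<ge> 0" "e \<in> D" using zw by (auto simp: Z_def)
    \<comment> \<open>Two competitors \<open>(t, d)\<close> and \<open>(u, e)\<close> merge into \<open>(t + u, k)\<close>, where
      \<open>k\<close> is their weighted mean; for \<open>t = u = 0\<close> any point of \<open>D\<close> serves.\<close>
    obtain k where k: "k \<in> D" "(t + u) *\<^sub>R k = t *\<^sub>R d + u *\<^sub>R e"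
    proof (cases "t + u = 0")
      case True
      then have "t = 0" "u = 0" using z w by auto
      then show thesis using that[of d] z by simp
    next
      case False
      have "(t / (t + u)) *\<^sub>R d + (u / (t + u)) *\<^sub>R e \<in> D"
        using z w False by (intro convexD[OF D(1)]) (auto simp: add_divide_distrib[symmetric])
      then show thesis using that False by (fastforce simp: scaleR_add_right)
    qed
    have "q (x + y) \<le> h (x + y) (t + u, k)" using z w k by (intro le) (auto simp: Z_def)
    also have "\<dots> = p ((x + t *\<^sub>R d) + (y + u *\<^sub>R e)) - (t + u) * c"
      by (simp add: h_def k add_ac)
    also have "\<dots> \<le> h x z + h y w"
      using sublinear_add[OF p, of "x + t *\<^sub>R d" "y + u *\<^sub>R e"]
      by (simp add: h_def z w algebra_simps)
    finally show ?thesis .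
  qed
  have "sublinear q"
  proof (rule sublinearI)
    fix x y
    have "q (x + y) - q y \<le> q x"
    proof (rule ge)
      fix z assume z: "z \<in> Z"
      have "q (x + y) - h x z \<le> q y"
      proof (rule ge)
        fix w assume "w \<in> Z"
        from add[OF z this, of x y] show "q (x + y) - h x z \<le> h y w" by simp
      qed
      then show "q (x + y) - q y \<le> h x z" by simp
    qed
    then show "q (x + y) \<le> q x + q y" by simp
  next
    fix k :: real and x assume k: "k > 0"
    have "q (k *\<^sub>R x) / k \<le> q x"
    proof (rule ge)
      fix z assume "z \<in> Z"
      then obtain t d where z: "z = (t, d)" "t \<ge> 0" "d \<in> D" by (auto simp: Z_def)
      have "q (k *\<^sub>R x) \<le> h (k *\<^sub>R x) (k * t, d)" using z k by (intro le) (auto simp: Z_def)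
      also have "\<dots> = k * h x z"
        using sublinear_scaleR[OF p k, of "x + t *\<^sub>R d"] by (simp add: h_def z algebra_simps)
      finally show "q (k *\<^sub>R x) / k \<le> h x z" using k by (simp add: field_simps)
    qed
    then show "q (k *\<^sub>R x) \<le> k * q x" using k by (simp add: field_simps)
  qed
  moreover have "q x \<le> p x" for x
  proof -
    obtain d where "d \<in> D" using D by auto
    then show ?thesis using le[of "(0, d)" x] by (simp add: Z_def h_def)
  qed
  moreover have "q (- d) \<le> - c" if "d \<in> D" for d
    using le[of "(1, d)" "- d"] that sublinear_zero[OF p] by (simp add: Z_def h_def)
  ultimately show thesis by (rule that)
qed

text \<open>By the preceding lemma with \<open>D = {y}\<close> and \<open>c = q y\<close>, some sublinear minorant of \<open>q\<close> has value at
most \<open>- q y\<close> at \<open>- y\<close>. Minimality makes this minorant equal to \<open>q\<close>, so \<open>q\<close> is odd, and an odd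
sublinear functional is linear.\<close>

lemma minimal_sublinear_imp_linear:
  assumes q: "sublinear q"
    and minimal: "\<And>r. sublinear r \<Longrightarrow> (\<And>x. r x \<le> q x) \<Longrightarrow> r = q"
  shows "linear q"
proof -
  have neg: "q (- y) = - q y" for y
  proof -
    obtain r where "sublinear r" "\<And>x. r x \<le> q x" "r (- y) \<le> - q y"
      by (rule sublinear_minorant_below[OF q, of "{y}" "q y"]) auto
    with minimal[of r] sublinear_uminus_ge[OF q, of "- y"] show ?thesis by auto
  qed
  show ?thesis
  proof (rule linearI)
    fix x y
    have "- q (x + y) \<le> - q x - q y"
      using sublinear_add[OF q, of "- x" "- y"] neg[of "x + y"] neg[of x] neg[of y] by simp
    then show "q (x + y) = q x + q y" using sublinear_add[OF q, of x y] by simp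
  next
    fix c :: real and x
    consider "c > 0" | "c = 0" | "c < 0" by linarith
    then show "q (c *\<^sub>R x) = c *\<^sub>R q x"
    proof cases
      case 3
      then show ?thesis using sublinear_scaleR[OF q, of "- c" x] neg[of "c *\<^sub>R x"] by simp
    qed (simp_all add: sublinear_scaleR[OF q] sublinear_zero[OF q])
  qed
qed

text \<open>The bound \<open>q x \<ge> - p (- x)\<close>, common to all sublinear \<open>q \<le> p\<close>, makes the infimum finite. In a
chain the smaller of two members bounds both terms, so subadditivity survives the infimum. This
supplies the lower bounds needed for Zorn's lemma.\<close>

lemma sublinear_INF_chain:
  fixes p :: "'a::real_vector \<Rightarrow> real"
  assumes ne: "Q \<noteq> {}" and Q: "\<And>q. q \<in> Q \<Longrightarrow> sublinear q \<and> q \<le> p"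
    and chain: "\<And>q r. q \<in> Q \<Longrightarrow> r \<in> Q \<Longrightarrow> q \<le> r \<or> r \<le> q"
  shows "sublinear (\<lambda>x. INF q\<in>Q. q x)" and "q \<in> Q \<Longrightarrow> (INF q\<in>Q. q x) \<le> q x"
proof -
  define u where "u = (\<lambda>x. INF q\<in>Q. q x)"
  have bdd: "bdd_below ((\<lambda>q. q x) ` Q)" for x
  proof (rule bdd_belowI2[where m = "- p (- x)"])
    fix q assume "q \<in> Q"
    then have "sublinear q" "q (- x) \<le> p (- x)" using Q by (auto simp: le_fun_def)
    then show "- p (- x) \<le> q x" using sublinear_uminus_ge[of q x] by linarith
  qed
  have le: "u x \<le> q x" if "q \<in> Q" for x q
    unfolding u_def by (rule cINF_lower[OF bdd that])
  have ge: "m \<le> u x" if "\<And>q. q \<in> Q \<Longrightarrow> m \<le> q x" for m x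
    unfolding u_def by (rule cINF_greatest[OF ne that])
  have add: "u (x + y) \<le> q x + r y" if qr: "q \<in> Q" "r \<in> Q" for x y q r
  proof -
    obtain m where m: "m \<in> Q" "m \<le> q" "m \<le> r" using chain[OF qr] qr by blast
    have "u (x + y) \<le> m x + m y"
      using le[OF m(1), of "x + y"] sublinear_add[of m x y] Q[OF m(1)] by linarith
    also have "\<dots> \<le> q x + r y" using m by (intro add_mono) (auto simp: le_fun_def)
    finally show ?thesis .
  qed
  have "sublinear u"
  proof (rule sublinearI)
    fix x y
    have "u (x + y) - u y \<le> u x"
    proof (rule ge)
      fix q assume q: "q \<in> Q"
      have "u (x + y) - q x \<le> u y"
      proof (rule ge)
        fix r assume "r \<in> Q"
        from add[OF q this, of x y] show "u (x + y) - q x \<le> r y" by simp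
      qed
      then show "u (x + y) - u y \<le> q x" by simp
    qed
    then show "u (x + y) \<le> u x + u y" by simp
  next
    fix k :: real and x assume k: "k > 0"
    have "u (k *\<^sub>R x) / k \<le> u x"
    proof (rule ge)
      fix q assume q: "q \<in> Q"
      then have "u (k *\<^sub>R x) \<le> k * q x"
        using le[OF q, of "k *\<^sub>R x"] sublinear_scaleR[of q k x] Q k by simp
      then show "u (k *\<^sub>R x) / k \<le> q x" using k by (simp add: field_simps)
    qed
    then show "u (k *\<^sub>R x) \<le> k * u x" using k by (simp add: field_simps)
  qed
  then show "sublinear (\<lambda>x. INF q\<in>Q. q x)" by (simp add: u_def)
  show "q \<in> Q \<Longrightarrow> (INF q\<in>Q. q x) \<le> q x" using le by (simp add: u_def)
qed

text \<open>This is the Hahn-Banach theorem in the form that needs no extension from subspaces: a minimal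
sublinear functional below \<open>p\<close> exists by Zorn's lemma and is linear.\<close>

lemma linear_minorant_of_sublinear:
  fixes p :: "'a::real_vector \<Rightarrow> real"
  assumes p: "sublinear p"
  obtains \<phi> where "linear \<phi>" "\<And>x. \<phi> x \<le> p x"
proof -
  define S where "S = {q. sublinear q \<and> q \<le> p}"
  have "\<exists>m\<in>S. \<forall>q\<in>S. q \<le> m \<longrightarrow> q = m"
  proof (rule predicate_Zorn)
    show "partial_order_on S (relation_of (\<lambda>q r. r \<le> q) S)"
      by (rule partial_order_on_relation_ofI) auto
  next
    fix Q assume "Q \<in> Chains (relation_of (\<lambda>q r. r \<le> q) S)"
    then have Q: "\<And>q r. q \<in> Q \<Longrightarrow> r \<in> Q \<Longrightarrow> q \<in> S \<and> (q \<le> r \<or> r \<le> q)"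
      unfolding Chains_def relation_of_def by auto
    show "\<exists>u\<in>S. \<forall>q\<in>Q. u \<le> q"
    proof (cases "Q = {}")
      case True
      then show ?thesis using p by (auto simp: S_def)
    next
      case False
      define u where "u = (\<lambda>x. INF q\<in>Q. q x)"
      have sub: "\<And>q. q \<in> Q \<Longrightarrow> sublinear q \<and> q \<le> p" using Q by (auto simp: S_def)
      have chain: "\<And>q r. q \<in> Q \<Longrightarrow> r \<in> Q \<Longrightarrow> q \<le> r \<or> r \<le> q" using Q by blast
      have u: "sublinear u" "\<And>q. q \<in> Q \<Longrightarrow> u \<le> q"
        unfolding u_def le_fun_def using sublinear_INF_chain[OF False sub chain] by blast+
      moreover have "u \<le> p" using False u(2) sub by (meson ex_in_conv order_trans)
      ultimately show ?thesis by (auto simp: S_def)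
    qed
  qed
  then obtain m where m: "sublinear m" "m \<le> p" and min: "\<And>q. q \<in> S \<Longrightarrow> q \<le> m \<Longrightarrow> q = m"
    by (auto simp: S_def)
  have "linear m"
  proof (rule minimal_sublinear_imp_linear[OF m(1)])
    fix r assume "sublinear r" "\<And>x. r x \<le> m x"
    moreover from this(2) have "r \<le> m" by (simp add: le_fun_def)
    ultimately show "r = m" using min[of r] m(2) by (auto simp: S_def)
  qed
  with m(2) show thesis by (intro that[of m]) (auto simp: le_fun_def)
qed

section \<open>Separation of convex sets\<close>

definition absorbing :: "'a::real_vector set \<Rightarrow> bool" where
  "absorbing U \<longleftrightarrow> (\<forall>x. \<exists>t>0. t *\<^sub>R x \<in> U)"

definition minkowski :: "'a::real_vector set \<Rightarrow> 'a \<Rightarrow> real" where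
  "minkowski U x = Inf {t. t > 0 \<and> inverse t *\<^sub>R x \<in> U}"

lemma minkowski_le: "t > 0 \<Longrightarrow> inverse t *\<^sub>R x \<in> U \<Longrightarrow> minkowski U x \<le> t"
  unfolding minkowski_def by (rule cInf_lower) (auto intro!: bdd_belowI[of _ 0])

lemma minkowski_ge:
  assumes "absorbing U" and "\<And>t. t > 0 \<Longrightarrow> inverse t *\<^sub>R x \<in> U \<Longrightarrow> m \<le> t"
  shows "m \<le> minkowski U x"
  unfolding minkowski_def
proof (rule cInf_greatest)
  obtain t where "t > 0" "t *\<^sub>R x \<in> U" using assms(1) by (auto simp: absorbing_def)
  then have "inverse t \<in> {t. t > 0 \<and> inverse t *\<^sub>R x \<in> U}" by simp
  then show "{t. t > 0 \<and> inverse t *\<^sub>R x \<in> U} \<noteq> {}" by blast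
qed (use assms(2) in auto)

lemma sublinear_minkowski:
  assumes U: "convex U" "absorbing U"
  shows "sublinear (minkowski U)"
proof (rule sublinearI)
  fix x y
  have "minkowski U (x + y) - minkowski U y \<le> minkowski U x"
  proof (rule minkowski_ge[OF U(2)])
    fix t :: real assume t: "t > 0" "inverse t *\<^sub>R x \<in> U"
    have "minkowski U (x + y) - t \<le> minkowski U y"
    proof (rule minkowski_ge[OF U(2)])
      fix u :: real assume u: "u > 0" "inverse u *\<^sub>R y \<in> U"
      have "(t / (t + u)) *\<^sub>R (inverse t *\<^sub>R x) + (u / (t + u)) *\<^sub>R (inverse u *\<^sub>R y) \<in> U"
        using t u by (intro convexD[OF U(1)]) (auto simp: add_divide_distrib[symmetric])
      also have "(t / (t + u)) *\<^sub>R (inverse t *\<^sub>R x) + (u / (t + u)) *\<^sub>R (inverse u *\<^sub>R y)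
          = inverse (t + u) *\<^sub>R (x + y)"
        using t u by (simp add: scaleR_add_right inverse_eq_divide)
      finally have "minkowski U (x + y) \<le> t + u" using t u by (intro minkowski_le) auto
      then show "minkowski U (x + y) - t \<le> u" by simp
    qed
    then show "minkowski U (x + y) - minkowski U y \<le> t" by simp
  qed
  then show "minkowski U (x + y) \<le> minkowski U x + minkowski U y" by simp
next
  fix c :: real and x assume c: "c > 0"
  have "minkowski U (c *\<^sub>R x) / c \<le> minkowski U x"
  proof (rule minkowski_ge[OF U(2)])
    fix t :: real assume t: "t > 0" "inverse t *\<^sub>R x \<in> U"
    have "inverse (c * t) *\<^sub>R (c *\<^sub>R x) = inverse t *\<^sub>R x" using c t by (simp add: field_simps)
    then have "minkowski U (c *\<^sub>R x) \<le> c * t" using c t(1) t(2) by (metis minkowski_le mult_pos_pos)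
    then show "minkowski U (c *\<^sub>R x) / c \<le> t" using c by (simp add: field_simps)
  qed
  then show "minkowski U (c *\<^sub>R x) \<le> c * minkowski U x" using c by (simp add: field_simps)
qed

text \<open>The gauge \<open>p\<close> of \<open>U\<close> is at most \<open>1\<close> on \<open>U\<close> and at least \<open>1\<close> off \<open>U\<close>, hence on \<open>D\<close>. So \<open>p\<close> has a
sublinear minorant \<open>q\<close> with \<open>q (- d) \<le> - 1\<close> on \<open>D\<close>, and every linear functional below \<open>q\<close>
separates.\<close>

theorem convex_separation_absorbing:
  fixes U D :: "'a::real_vector set"
  assumes U: "convex U" "absorbing U" and D: "convex D" "D \<noteq> {}" and disj: "U \<inter> D = {}"
  obtains \<phi> :: "'a \<Rightarrow> real"
  where "linear \<phi>" "\<And>u. u \<in> U \<Longrightarrow> \<phi> u \<le> 1" "\<And>d. d \<in> D \<Longrightarrow> 1 \<le> \<phi> d"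
proof -
  have off: "1 \<le> minkowski U d" if "d \<in> D" for d
  proof (rule minkowski_ge[OF U(2)], rule ccontr)
    fix t :: real assume t: "t > 0" "inverse t *\<^sub>R d \<in> U" "\<not> 1 \<le> t"
    have "0 \<in> U" using U(2) unfolding absorbing_def by (metis scaleR_zero_right)
    then have "t *\<^sub>R (inverse t *\<^sub>R d) + (1 - t) *\<^sub>R 0 \<in> U" using t by (intro convexD[OF U(1)]) auto
    then show False using t that disj by auto
  qed
  obtain q where q: "sublinear q" "\<And>x. q x \<le> minkowski U x" "\<And>d. d \<in> D \<Longrightarrow> q (- d) \<le> - 1"
    using sublinear_minorant_below[OF sublinear_minkowski[OF U] D off] by blast
  obtain \<phi> where \<phi>: "linear \<phi>" "\<And>x. \<phi> x \<le> q x"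
    using linear_minorant_of_sublinear[OF q(1)] by blast
  show thesis
  proof (rule that[OF \<phi>(1)])
    fix u assume "u \<in> U"
    then have "minkowski U u \<le> 1" by (intro minkowski_le) auto
    then show "\<phi> u \<le> 1" using \<phi>(2)[of u] q(2)[of u] by linarith
  next
    fix d assume "d \<in> D"
    then show "1 \<le> \<phi> d" using \<phi>(2)[of "- d"] q(3)[of d] linear_neg[OF \<phi>(1), of d] by simp
  qed
qed

section \<open>Locally convex spaces and their weak-star dual\<close>

lemma absorbing_open_zero:
  fixes U :: "'a::locally_convex_space set"
  assumes "open U" "0 \<in> U"
  shows "absorbing U"
  unfolding absorbing_def
proof
  fix x :: 'a
  have "filterlim (\<lambda>t::real. (t, x)) (nhds 0 \<times>\<^sub>F nhds x) (at_right 0)"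
    by (intro filterlim_Pair tendsto_const filterlim_mono[OF filterlim_ident order_refl])
      (simp add: at_within_def)
  from filterlim_compose[OF tendsto_scaleR_nhds this]
  have "((\<lambda>t. t *\<^sub>R x) \<longlongrightarrow> 0) (at_right 0)" by simp
  then have "eventually (\<lambda>t. t *\<^sub>R x \<in> U) (at_right 0)"
    using assms by (rule topological_tendstoD)
  then have "eventually (\<lambda>t. t > 0 \<and> t *\<^sub>R x \<in> U) (at_right 0)"
    using eventually_at_right_less by eventually_elim auto
  then show "\<exists>t>0. t *\<^sub>R x \<in> U"
    using eventually_happens trivial_limit_at_right_real by blast
qed

text \<open>The functional is at most \<open>1\<close> at \<open>c (y - x)\<close> for \<open>y\<close> near \<open>x\<close>, whatever the scalar \<open>c\<close>. The
choices \<open>c = 2 / e\<close> and \<open>c = - 2 / e\<close> bound the increment from both sides by \<open>e / 2\<close>, which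
avoids a symmetric neighbourhood.\<close>

lemma continuous_on_linear_bounded_above:
  fixes \<phi> :: "'a::locally_convex_space \<Rightarrow> real"
  assumes lin: "linear \<phi>" and U: "open U" "0 \<in> U" and le: "\<And>u. u \<in> U \<Longrightarrow> \<phi> u \<le> 1"
  shows "continuous_on UNIV \<phi>"
proof -
  have "(\<phi> \<longlongrightarrow> \<phi> x) (nhds x)" for x
  proof (rule tendstoI)
    fix e :: real assume e: "e > 0"
    have diff: "((\<lambda>y. y - x) \<longlongrightarrow> 0) (nhds x)"
      using tendsto_diff[OF filterlim_ident[of "nhds x"] tendsto_const[of x]] by simp
    have small: "eventually (\<lambda>y. \<phi> (c *\<^sub>R (y - x)) \<le> 1) (nhds x)" for c
    proof -
      have "filterlim (\<lambda>y. (c, y - x)) (nhds c \<times>\<^sub>F nhds 0) (nhds x)"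
        by (intro filterlim_Pair tendsto_const diff)
      from filterlim_compose[OF tendsto_scaleR_nhds this]
      have "((\<lambda>y. c *\<^sub>R (y - x)) \<longlongrightarrow> 0) (nhds x)" by simp
      then have "eventually (\<lambda>y. c *\<^sub>R (y - x) \<in> U) (nhds x)"
        using U by (rule topological_tendstoD)
      then show ?thesis by eventually_elim (rule le)
    qed
    from small[of "2 / e"] small[of "- (2 / e)"]
    show "eventually (\<lambda>y. dist (\<phi> y) (\<phi> x) < e) (nhds x)"
    proof eventually_elim
      case (elim y)
      then have "2 / e * (\<phi> y - \<phi> x) \<le> 1" "- (2 / e) * (\<phi> y - \<phi> x) \<le> 1"
        by (simp_all add: linear_scale[OF lin] linear_diff[OF lin] linear_neg[OF lin])
      then have "\<phi> y - \<phi> x \<le> e / 2" "\<phi> x - \<phi> y \<le> e / 2"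
        using e by (simp_all add: field_simps)
      then show ?case using e by (simp add: dist_real_def abs_less_iff)
    qed
  qed
  then show ?thesis by (simp add: continuous_on_def tendsto_at_iff_tendsto_nhds)
qed

lemma dual_apply_linear: "linear (dual_apply \<phi>)"
  using dual_apply[of \<phi>] by auto

lemma dual_apply_simps [simp]:
  "dual_apply 0 x = 0"
  "dual_apply (\<phi> + \<psi>) x = dual_apply \<phi> x + dual_apply \<psi> x"
  "dual_apply (\<phi> - \<psi>) x = dual_apply \<phi> x - dual_apply \<psi> x"
  "dual_apply (- \<phi>) x = - dual_apply \<phi> x"
  "dual_apply (c *\<^sub>R \<phi>) x = c * dual_apply \<phi> x"
  by (transfer, simp)+

lemma dual_apply_arg_simps [simp]:
  "dual_apply \<phi> (x + y) = dual_apply \<phi> x + dual_apply \<phi> y"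
  "dual_apply \<phi> (c *\<^sub>R x) = c * dual_apply \<phi> x"
  using dual_apply_linear[of \<phi>] by (simp_all add: linear_add linear_scale)

lemma continuous_on_evaluation: "continuous_on UNIV (\<lambda>\<phi>. dual_apply \<phi> x)"
  unfolding continuous_on_open_vimage[OF open_UNIV] open_top_dual_def
  by (auto intro!: generate_topology.Basis)

text \<open>A weak-star neighbourhood restrains only finitely many evaluations. This finiteness is what
forces separating functionals on the dual to be evaluations.\<close>

lemma weak_star_open_basis:
  fixes W :: "'a::locally_convex_space top_dual set"
  assumes "open W" "\<phi> \<in> W"
  shows "\<exists>F e. finite F \<and> e > 0 \<and>
    (\<forall>\<psi>. (\<forall>x\<in>F. \<bar>dual_apply \<psi> x - dual_apply \<phi> x\<bar> < e) \<longrightarrow> \<psi> \<in> W)"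
proof -
  have "generate_topology {(\<lambda>\<phi>::'a top_dual. dual_apply \<phi> x) -` W |x W. open W} W"
    using assms(1) by (simp add: open_top_dual_def)
  then show ?thesis using assms(2)
  proof induction
    case UNIV
    show ?case by (intro exI[of _ "{}"] exI[of _ 1]) auto
  next
    case (Int a b)
    from Int.IH(1) Int.prems obtain F e where "finite F" "e > 0"
      "\<forall>\<psi>. (\<forall>x\<in>F. \<bar>dual_apply \<psi> x - dual_apply \<phi> x\<bar> < e) \<longrightarrow> \<psi> \<in> a" by auto
    moreover from Int.IH(2) Int.prems obtain G d where "finite G" "d > 0"
      "\<forall>\<psi>. (\<forall>x\<in>G. \<bar>dual_apply \<psi> x - dual_apply \<phi> x\<bar> < d) \<longrightarrow> \<psi> \<in> b" by auto
    ultimately show ?case by (intro exI[of _ "F \<union> G"] exI[of _ "min e d"]) auto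
  next
    case (UN K)
    then obtain k where k: "k \<in> K" "\<phi> \<in> k" by auto
    from UN.IH[OF this] obtain F e where "finite F" "e > 0"
      "\<forall>\<psi>. (\<forall>x\<in>F. \<bar>dual_apply \<psi> x - dual_apply \<phi> x\<bar> < e) \<longrightarrow> \<psi> \<in> k" by auto
    with k(1) show ?case by (intro exI[of _ F] exI[of _ e]) auto
  next
    case (Basis a)
    then obtain x V where "a = (\<lambda>\<phi>. dual_apply \<phi> x) -` V" "open V" by auto
    with Basis obtain e where "e > 0" "ball (dual_apply \<phi> x) e \<subseteq> V"
      by (auto simp: open_contains_ball)
    with \<open>a = _\<close> show ?case
      by (intro exI[of _ "{x}"] exI[of _ e]) (auto simp: dist_real_def abs_minus_commute subset_iff)
  qed
qed

text \<open>Induction on \<open>F\<close>: unless \<open>a\<close> can be dropped from the list, there is \<open>\<theta>\<close> vanishing on \<open>F\<close> but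
not at \<open>a\<close>, and subtracting the multiple of the evaluation at \<open>a\<close> that matches \<open>\<Psi>\<close> at
\<open>\<theta>\<close> leaves a functional that is controlled by \<open>F\<close> alone.\<close>

lemma functional_is_evaluation:
  fixes \<Psi> :: "'a::locally_convex_space top_dual \<Rightarrow> real"
  assumes "finite F" "linear \<Psi>" "\<And>\<phi>. (\<forall>x\<in>F. dual_apply \<phi> x = 0) \<Longrightarrow> \<Psi> \<phi> = 0"
  shows "\<exists>x. \<forall>\<phi>. \<Psi> \<phi> = dual_apply \<phi> x"
  using assms
proof (induction F arbitrary: \<Psi>)
  case empty
  then have "\<forall>\<phi>. \<Psi> \<phi> = dual_apply \<phi> 0" by (simp add: linear_0[OF dual_apply_linear])
  then show ?case by blast
next
  case (insert a F)
  show ?case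
  proof (cases "\<exists>\<phi>. (\<forall>x\<in>F. dual_apply \<phi> x = 0) \<and> dual_apply \<phi> a \<noteq> 0")
    case False
    with insert show ?thesis by (metis insert_iff)
  next
    case True
    then obtain \<theta> where \<theta>: "\<forall>x\<in>F. dual_apply \<theta> x = 0" "dual_apply \<theta> a \<noteq> 0" by blast
    define k where "k = \<Psi> \<theta> / dual_apply \<theta> a"
    have "\<exists>x. \<forall>\<phi>. \<Psi> \<phi> - k * dual_apply \<phi> a = dual_apply \<phi> x"
    proof (rule insert.IH)
      show "linear (\<lambda>\<phi>. \<Psi> \<phi> - k * dual_apply \<phi> a)"
        using insert.prems(1) by (simp add: linear_iff algebra_simps)
    next
      fix \<phi> assume \<phi>: "\<forall>x\<in>F. dual_apply \<phi> x = 0"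
      have "\<Psi> (\<phi> - (dual_apply \<phi> a / dual_apply \<theta> a) *\<^sub>R \<theta>) = 0"
        using \<phi> \<theta> by (intro insert.prems(2)) auto
      then show "\<Psi> \<phi> - k * dual_apply \<phi> a = 0"
        by (simp add: linear_diff[OF insert.prems(1)] linear_scale[OF insert.prems(1)] k_def)
    qed
    then obtain x where "\<And>\<phi>. \<Psi> \<phi> = dual_apply \<phi> (x + k *\<^sub>R a)"
      by (metis diff_add_cancel dual_apply_arg_simps)
    then show ?thesis by blast
  qed
qed

section \<open>Separation in a product with the real line\<close>

lemma absorbing_Times:
  assumes U: "convex U" "absorbing U" and V: "convex V" "absorbing V"
  shows "absorbing (U \<times> V)"
  unfolding absorbing_def
proof
  have shrink: "t *\<^sub>R z \<in> S"
    if S: "convex S" "absorbing S" and t: "0 < t" "t \<le> u" "u *\<^sub>R z \<in> S"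
    for t u and z :: "'c::real_vector" and S
  proof -
    have "0 \<in> S" using S(2) unfolding absorbing_def by (metis scaleR_zero_right)
    then have "(t / u) *\<^sub>R (u *\<^sub>R z) + (1 - t / u) *\<^sub>R 0 \<in> S" using t by (intro convexD[OF S(1)]) auto
    then show ?thesis using t by simp
  qed
  fix p :: "'a \<times> 'b"
  obtain t u where tu: "t > 0" "t *\<^sub>R fst p \<in> U" "u > 0" "u *\<^sub>R snd p \<in> V"
    using U(2) V(2) unfolding absorbing_def by metis
  have "min t u *\<^sub>R fst p \<in> U" "min t u *\<^sub>R snd p \<in> V"
    using shrink[OF U, of "min t u" t] shrink[OF V, of "min t u" u] tu by auto
  then show "\<exists>t>0. t *\<^sub>R p \<in> U \<times> V"
    using tu by (intro exI[of _ "min t u"]) (auto simp: scaleR_prod_def)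
qed

text \<open>The form in which separation is used below, both in \<open>X \<times> \<real>\<close> and in \<open>X\<^sup>* \<times> \<real>\<close>. The
box \<open>U \<times> {- \<delta><..<\<delta>}\<close> around \<open>(x, \<beta>)\<close> is absorbing, so no topology on the product is involved.
The separating functional is written as \<open>(y, r) \<mapsto> \<psi> y + c r\<close>. The bound \<open>\<psi> \<le> 1\<close> on \<open>U\<close>
is kept because it makes \<open>\<psi>\<close> continuous. The gap is normalised to \<open>1\<close>.\<close>

lemma separation_from_box:
  fixes U :: "'a::real_vector set" and \<beta> :: real
  assumes U: "convex U" "absorbing U" and \<delta>: "\<delta> > 0" and E: "convex E" "E \<noteq> {}"
    and disj: "\<And>u r. u \<in> U \<Longrightarrow> \<bar>r\<bar> < \<delta> \<Longrightarrow> (x + u, \<beta> + r) \<notin> E"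
  obtains \<psi> :: "'a \<Rightarrow> real" and c :: real
  where "linear \<psi>" "\<forall>u\<in>U. \<psi> u \<le> 1"
    "\<forall>y r. (y, r) \<in> E \<longrightarrow> \<psi> x + c * \<beta> + 1 \<le> \<psi> y + c * r"
proof -
  let ?B = "{- \<delta><..<\<delta>}" and ?D = "(\<lambda>p. p - (x, \<beta>)) ` E"
  have "absorbing ?B" using \<delta> by (intro absorbing_open_zero) auto
  then have B: "convex (U \<times> ?B)" "absorbing (U \<times> ?B)"
    using U by (auto intro: convex_Times absorbing_Times)
  have D: "convex ?D" "?D \<noteq> {}" using E by (simp_all add: convex_translation_subtract)
  have "p - (x, \<beta>) \<notin> U \<times> ?B" if "p \<in> E" for p
    using disj[of "fst p - x" "snd p - \<beta>"] that by (cases p) (auto simp: abs_less_iff)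
  then have "U \<times> ?B \<inter> ?D = {}" by (metis (no_types, lifting) disjoint_iff imageE)
  from convex_separation_absorbing[OF B D this] obtain \<Phi> :: "'a \<times> real \<Rightarrow> real" where
    \<Phi>: "linear \<Phi>" "\<And>p. p \<in> U \<times> ?B \<Longrightarrow> \<Phi> p \<le> 1" "\<And>p. p \<in> ?D \<Longrightarrow> 1 \<le> \<Phi> p" by blast
  have split: "\<Phi> (y, r) = \<Phi> (y, 0) + \<Phi> (0, 1) * r" for y r
    using linear_add[OF \<Phi>(1), of "(y, 0)" "r *\<^sub>R (0, 1)"] linear_scale[OF \<Phi>(1), of r "(0, 1)"]
    by simp
  show thesis
  proof (rule that[of "\<lambda>y. \<Phi> (y, 0)" "\<Phi> (0, 1)"]; (intro allI ballI impI)?)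
    show "linear (\<lambda>y. \<Phi> (y, 0))"
      using linear_add[OF \<Phi>(1), of "(_, 0)" "(_, 0)"] linear_scale[OF \<Phi>(1), of _ "(_, 0)"]
      by (intro linearI) simp_all
  next
    fix u assume "u \<in> U"
    then show "\<Phi> (u, 0) \<le> 1" using \<delta> by (intro \<Phi>(2)) auto
  next
    fix y r assume "(y, r) \<in> E"
    then have "1 \<le> \<Phi> ((y, r) - (x, \<beta>))" by (intro \<Phi>(3)) blast
    then show "\<Phi> (x, 0) + \<Phi> (0, 1) * \<beta> + 1 \<le> \<Phi> (y, 0) + \<Phi> (0, 1) * r"
      using split[of y r] split[of x \<beta>] linear_diff[OF \<Phi>(1), of "(y, r)" "(x, \<beta>)"] by simp
  qed
qed

lemma nonneg_slope:
  fixes a b m r\<^sub>0 :: real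
  assumes "\<And>r. r \<ge> r\<^sub>0 \<Longrightarrow> a - b * r \<le> m"
  shows "b \<ge> 0"
proof (rule ccontr)
  assume b: "\<not> b \<ge> 0"
  define r where "r = max r\<^sub>0 ((a - m - 1) / b)"
  have "b * r \<le> b * ((a - m - 1) / b)" using b by (intro mult_left_mono_neg) (auto simp: r_def)
  then have "b * r \<le> a - m - 1" using b by simp
  moreover have "a - b * r \<le> m" by (rule assms) (simp add: r_def)
  ultimately show False by simp
qed

text \<open>Gaps are normalised to \<open>1\<close>, so this is the room available for adding a small multiple of a second
inequality to a possibly vertical separation.\<close>

lemma small_multiple:
  fixes k :: real
  obtains \<epsilon> where "\<epsilon> > 0" "\<epsilon> * k < 1"
proof
  show "1 / (\<bar>k\<bar> + 1) > 0" "1 / (\<bar>k\<bar> + 1) * k < 1" by (auto simp: field_simps)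
qed

section \<open>Convex conjugates\<close>

text \<open>Reading members of the epigraph as affine minorants replaces the supremum in the conjugate, with its
difference of extended reals, by pointwise inequalities whose left side is real.\<close>

lemma mem_epi_conjugate:
  "(\<phi>, r) \<in> epi (conjugate h) \<longleftrightarrow> (\<forall>x. ereal (dual_apply \<phi> x - r) \<le> h x)"
proof -
  have "ereal a - c \<le> ereal r \<longleftrightarrow> ereal (a - r) \<le> c" for a c by (cases c) auto
  then show ?thesis by (auto simp: epi_def conjugate_def SUP_le_iff)
qed

lemma convex_epi_conjugate: "convex (epi (conjugate h))"
proof -
  have "convex {p. ereal (dual_apply (fst p) x - snd p) \<le> h x}" for x
  proof (cases "h x")
    case (real c)
    have "linear (\<lambda>p. dual_apply (fst p) x - snd p)" by (simp add: linear_iff algebra_simps)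
    then have "convex ((\<lambda>p. dual_apply (fst p) x - snd p) -` {..c})"
      by (rule convex_linear_vimage) simp
    then show ?thesis by (simp add: real vimage_def)
  qed auto
  moreover have "epi (conjugate h) = (\<Inter>x. {p. ereal (dual_apply (fst p) x - snd p) \<le> h x})"
    by (auto simp: mem_epi_conjugate)
  ultimately show ?thesis by (simp add: convex_INT)
qed

lemma convex_epi:
  assumes "econvex h"
  shows "convex (epi h)"
  unfolding convex_alt
proof clarify
  fix x y :: 'a and a b t :: real
  assume *: "(x, a) \<in> epi h" "(y, b) \<in> epi h" "0 \<le> t" "t \<le> 1"
  show "(1 - t) *\<^sub>R (x, a) + t *\<^sub>R (y, b) \<in> epi h"
  proof (cases "t = 0 \<or> t = 1")
    case True
    then show ?thesis using * by auto
  next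
    case False
    with * have t: "0 < t" "t < 1" by auto
    then have "h ((1 - t) *\<^sub>R x + t *\<^sub>R y) \<le> ereal (1 - t) * h x + ereal t * h y"
      using assms by (simp add: econvex_def)
    also have "\<dots> \<le> ereal (1 - t) * ereal a + ereal t * ereal b"
      using * t by (intro add_mono ereal_mult_left_mono) (auto simp: epi_def)
    finally show ?thesis by (simp add: epi_def)
  qed
qed

text \<open>Lower semicontinuity provides, for \<open>\<beta> < \<gamma> < h x\<close>, a neighbourhood of \<open>x\<close> on which \<open>h > \<gamma>\<close>; so a
box of height \<open>\<gamma> - \<beta>\<close> around \<open>(x, \<beta>)\<close> misses the epigraph. As \<open>r\<close> is unbounded above on the
epigraph, the slope \<open>b\<close> is nonnegative; it may be \<open>0\<close> when \<open>x\<close> is outside the domain.\<close>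

lemma Gamma_separation:
  assumes h: "h \<in> Gamma_fun" and \<beta>: "ereal \<beta> < h x"
  obtains b \<phi> where "b \<ge> 0"
    "\<forall>y r. (y, r) \<in> epi h \<longrightarrow> dual_apply \<phi> y - b * r + 1 \<le> dual_apply \<phi> x - b * \<beta>"
proof -
  have "proper_fun h" "lsc_fun h" "econvex h" using h by (auto simp: Gamma_fun_def)
  obtain y\<^sub>0 where "h y\<^sub>0 \<noteq> \<infinity>" "h y\<^sub>0 \<noteq> - \<infinity>" using \<open>proper_fun h\<close> by (auto simp: proper_fun_def)
  then obtain r\<^sub>0 where r\<^sub>0: "h y\<^sub>0 = ereal r\<^sub>0" by (cases "h y\<^sub>0") auto
  obtain \<gamma> where \<gamma>: "\<beta> < \<gamma>" "ereal \<gamma> < h x" using ereal_dense2[OF \<beta>] by auto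
  have "eventually (\<lambda>y. ereal \<gamma> < h y) (nhds x)"
    using \<open>lsc_fun h\<close> \<gamma>(2) by (simp add: lsc_fun_def)
  then obtain S where S: "open S" "x \<in> S" "\<And>y. y \<in> S \<Longrightarrow> ereal \<gamma> < h y"
    unfolding eventually_nhds by auto
  have "open ((\<lambda>u. x + u) -` S)"
    by (intro open_vimage S continuous_intros)
  moreover have "0 \<in> (\<lambda>u. x + u) -` S" using S by simp
  ultimately obtain U where U: "open U" "convex U" "0 \<in> U" "U \<subseteq> (\<lambda>u. x + u) -` S"
    using convex_nhds_base by blast
  have disj: "(x + u, \<beta> + r) \<notin> epi h" if "u \<in> U" "\<bar>r\<bar> < \<gamma> - \<beta>" for u r
  proof -
    have "ereal (\<beta> + r) < ereal \<gamma>" using that by simp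
    also have "\<dots> < h (x + u)" using U that by (intro S) auto
    finally show ?thesis by (simp add: epi_def not_le)
  qed
  have ne: "epi h \<noteq> {}" using r\<^sub>0 by (auto simp: epi_def intro!: exI[of _ y\<^sub>0] exI[of _ r\<^sub>0])
  have pos: "\<gamma> - \<beta> > 0" using \<gamma>(1) by simp
  obtain \<psi> c where \<psi>: "linear \<psi>" "\<forall>u\<in>U. \<psi> u \<le> 1"
    "\<forall>y r. (y, r) \<in> epi h \<longrightarrow> \<psi> x + c * \<beta> + 1 \<le> \<psi> y + c * r"
    by (rule separation_from_box[OF U(2) absorbing_open_zero[OF U(1,3)] pos
        convex_epi[OF \<open>econvex h\<close>] ne disj])
  have "continuous_on UNIV \<psi>" by (rule continuous_on_linear_bounded_above[OF \<psi>(1) U(1,3)]) (use \<psi>(2) in auto)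
  with \<psi>(1) have dual: "dual_apply (Top_Dual \<psi>) = \<psi>" by (simp add: Top_Dual_inverse)
  show thesis
  proof (rule that[of c "- Top_Dual \<psi>"]; (intro allI impI)?)
    have "- \<psi> y\<^sub>0 - c * r \<le> - \<psi> x - c * \<beta> - 1" if "r \<ge> r\<^sub>0" for r
      using \<psi>(3)[rule_format, of y\<^sub>0 r] r\<^sub>0 that by (simp add: epi_def)
    then show "c \<ge> 0" by (rule nonneg_slope)
  next
    fix y r assume "(y, r) \<in> epi h"
    from \<psi>(3)[rule_format, OF this]
    show "dual_apply (- Top_Dual \<psi>) y - c * r + 1 \<le> dual_apply (- Top_Dual \<psi>) x - c * \<beta>"
      by (simp add: dual)
  qed
qed

lemma mem_epi_conjugateI:
  assumes "\<And>y s. (y, s) \<in> epi h \<Longrightarrow> dual_apply \<phi> y - s \<le> r"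
  shows "(\<phi>, r) \<in> epi (conjugate h)"
  unfolding mem_epi_conjugate
proof
  fix x
  show "ereal (dual_apply \<phi> x - r) \<le> h x"
  proof (rule ereal_le_real)
    fix s assume "h x \<le> ereal s"
    then have "(x, s) \<in> epi h" by (simp add: epi_def)
    from assms[OF this] show "ereal (dual_apply \<phi> x - r) \<le> ereal s" by simp
  qed
qed

lemma mem_epi_conjugate_scaled:
  assumes "k > 0" and "\<And>y s. (y, s) \<in> epi h \<Longrightarrow> dual_apply \<phi> y - k * s \<le> r"
  shows "(inverse k *\<^sub>R \<phi>, r / k) \<in> epi (conjugate h)"
proof (rule mem_epi_conjugateI)
  fix y s assume "(y, s) \<in> epi h"
  from divide_right_mono[OF assms(2)[OF this], of k] assms(1)
  show "dual_apply (inverse k *\<^sub>R \<phi>) y - s \<le> r / k"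
    by (simp add: diff_divide_distrib inverse_eq_divide)
qed

text \<open>Separation just below a point of the graph cannot be vertical: comparing with the point \<open>(y\<^sub>0, r\<^sub>0)\<close>
itself, which is above \<open>(y\<^sub>0, r\<^sub>0 - 1)\<close>, gives \<open>b \<ge> 1\<close>. Dividing by \<open>b\<close> produces an affine
minorant.\<close>

lemma epi_conjugate_nonempty:
  assumes h: "h \<in> Gamma_fun"
  shows "epi (conjugate h) \<noteq> {}"
proof -
  obtain y\<^sub>0 where "h y\<^sub>0 \<noteq> \<infinity>" "h y\<^sub>0 \<noteq> - \<infinity>" using h by (auto simp: Gamma_fun_def proper_fun_def)
  then obtain r\<^sub>0 where r\<^sub>0: "h y\<^sub>0 = ereal r\<^sub>0" by (cases "h y\<^sub>0") auto
  then have below: "ereal (r\<^sub>0 - 1) < h y\<^sub>0" by simp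
  obtain b \<phi> where "b \<ge> 0" and \<phi>: "\<forall>y r. (y, r) \<in> epi h \<longrightarrow>
      dual_apply \<phi> y - b * r + 1 \<le> dual_apply \<phi> y\<^sub>0 - b * (r\<^sub>0 - 1)"
    by (rule Gamma_separation[OF h below])
  have "b \<ge> 1" using \<phi>[rule_format, of y\<^sub>0 r\<^sub>0] r\<^sub>0 by (simp add: epi_def algebra_simps)
  then have "b > 0" by simp
  then have "(inverse b *\<^sub>R \<phi>, (dual_apply \<phi> y\<^sub>0 - b * (r\<^sub>0 - 1)) / b) \<in> epi (conjugate h)"
  proof (rule mem_epi_conjugate_scaled)
    fix y r assume "(y, r) \<in> epi h"
    from \<phi>[rule_format, OF this] show "dual_apply \<phi> y - b * r \<le> dual_apply \<phi> y\<^sub>0 - b * (r\<^sub>0 - 1)" by simp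
  qed
  then show ?thesis by blast
qed

text \<open>This is the nontrivial half \<open>h \<le> h\<^sup>*\<^sup>*\<close> of the biconjugate theorem. If \<open>\<beta> < h x\<close>, separate
\<open>(x, \<beta>)\<close> from the epigraph. A vertical separation is tilted by adding \<open>\<epsilon>\<close> times an affine minorant
\<open>\<theta> - q\<close> of \<open>h\<close>; the result is an affine minorant that exceeds \<open>\<beta>\<close> at \<open>x\<close>.\<close>

theorem fenchel_moreau:
  assumes h: "h \<in> Gamma_fun"
    and le: "\<And>\<phi> r. (\<phi>, r) \<in> epi (conjugate h) \<Longrightarrow> dual_apply \<phi> x - r \<le> \<beta>"
  shows "h x \<le> ereal \<beta>"
proof (rule ccontr)
  assume "\<not> h x \<le> ereal \<beta>"
  then have below: "ereal \<beta> < h x" by simp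
  obtain b \<phi> where \<phi>: "b \<ge> 0" "\<forall>y r. (y, r) \<in> epi h \<longrightarrow>
      dual_apply \<phi> y - b * r + 1 \<le> dual_apply \<phi> x - b * \<beta>"
    by (rule Gamma_separation[OF h below])
  obtain \<theta> q where \<theta>: "(\<theta>, q) \<in> epi (conjugate h)" using epi_conjugate_nonempty[OF h] by auto
  obtain \<epsilon> where \<epsilon>: "\<epsilon> > 0" "\<epsilon> * (q - dual_apply \<theta> x + \<beta>) < 1" by (rule small_multiple)
  define m where "m = dual_apply \<phi> x - b * \<beta> - 1 + \<epsilon> * q"
  define k where "k = b + \<epsilon>"
  have k: "k > 0" using \<phi>(1) \<epsilon>(1) by (simp add: k_def)
  have "(inverse k *\<^sub>R (\<phi> + \<epsilon> *\<^sub>R \<theta>), m / k) \<in> epi (conjugate h)"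
  proof (rule mem_epi_conjugate_scaled[OF k])
    fix y s assume ys: "(y, s) \<in> epi h"
    have "ereal (dual_apply \<theta> y - q) \<le> h y" using \<theta> by (simp add: mem_epi_conjugate)
    also have "\<dots> \<le> ereal s" using ys by (simp add: epi_def)
    finally have "\<epsilon> * (dual_apply \<theta> y - s) \<le> \<epsilon> * q" using \<epsilon>(1) by (intro mult_left_mono) auto
    then show "dual_apply (\<phi> + \<epsilon> *\<^sub>R \<theta>) y - k * s \<le> m"
      using \<phi>(2)[rule_format, OF ys] by (simp add: m_def k_def algebra_simps)
  qed
  from le[OF this] have "inverse k * (dual_apply \<phi> x + \<epsilon> * dual_apply \<theta> x) - m / k \<le> \<beta>" by simp
  then have "(dual_apply \<phi> x + \<epsilon> * dual_apply \<theta> x - m) / k \<le> \<beta>"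
    by (simp add: diff_divide_distrib inverse_eq_divide)
  then have "dual_apply \<phi> x + \<epsilon> * dual_apply \<theta> x - m \<le> \<beta> * k"
    using k by (simp add: pos_divide_le_eq)
  then show False using \<epsilon>(2) by (simp add: m_def k_def algebra_simps)
qed

lemma indicator_fun_Gamma:
  fixes C :: "'a::locally_convex_space set"
  assumes "C \<noteq> {}" "closed C" "convex C"
  shows "indicator_fun C \<in> Gamma_fun"
proof -
  have "proper_fun (indicator_fun C)"
    using assms(1) by (auto simp: proper_fun_def indicator_fun_def)
  moreover have "lsc_fun (indicator_fun C)"
    unfolding lsc_fun_def
  proof (intro allI impI)
    fix x a assume a: "a < indicator_fun C x"
    show "eventually (\<lambda>y. a < indicator_fun C y) (nhds x)"
    proof (cases "x \<in> C")
      case True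
      with a have "a < indicator_fun C y" for y by (auto simp: indicator_fun_def less_le_trans)
      then show ?thesis by simp
    next
      case False
      then have "eventually (\<lambda>y. y \<in> - C) (nhds x)"
        using assms(2) by (intro eventually_nhds_in_open) auto
      then show ?thesis using a False by (elim eventually_mono) (auto simp: indicator_fun_def)
    qed
  qed
  moreover have "econvex (indicator_fun C)"
    using convexD_alt[OF assms(3)] by (auto simp: econvex_def indicator_fun_def less_imp_le)
  ultimately show ?thesis by (simp add: Gamma_fun_def)
qed

section \<open>Separation in the weak-star dual\<close>

text \<open>A basic neighbourhood of \<open>(\<xi>, \<sigma>)\<close> that misses \<open>E\<close> restrains the values at the points of a finite
set \<open>F\<close>. The separating functional is bounded above on it, hence vanishes on all \<open>\<phi>\<close> that vanish
on \<open>F\<close>, since these form a subspace. So it is an evaluation.\<close>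

lemma weak_star_separation:
  fixes E :: "('a::locally_convex_space top_dual \<times> real) set"
  assumes E: "convex E" "E \<noteq> {}" and out: "(\<xi>, \<sigma>) \<notin> closure E"
  obtains x b where
    "\<forall>\<phi> r. (\<phi>, r) \<in> E \<longrightarrow> dual_apply \<phi> x - b * r + 1 \<le> dual_apply \<xi> x - b * \<sigma>"
proof -
  have "open (- closure E)" "(\<xi>, \<sigma>) \<in> - closure E" using out by auto
  then obtain A B where AB: "open A" "open B" "(\<xi>, \<sigma>) \<in> A \<times> B" "A \<times> B \<subseteq> - closure E"
    by (rule open_prod_elim)
  obtain F e where F: "finite F" "e > 0"
    "\<And>\<psi>. (\<forall>x\<in>F. \<bar>dual_apply \<psi> x - dual_apply \<xi> x\<bar> < e) \<Longrightarrow> \<psi> \<in> A"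
    using weak_star_open_basis[of A \<xi>] AB by auto
  obtain d where d: "d > 0" "ball \<sigma> d \<subseteq> B" using AB by (auto simp: open_contains_ball)
  define U where "U = {\<phi> :: 'a top_dual. \<forall>x\<in>F. \<bar>dual_apply \<phi> x\<bar> < e}"
  have conv: "convex U"
  proof -
    have "U = (\<Inter>x\<in>F. (\<lambda>\<phi>. dual_apply \<phi> x) -` {- e<..<e})" by (auto simp: U_def abs_less_iff)
    moreover have "linear (\<lambda>\<phi> :: 'a top_dual. dual_apply \<phi> x)" for x by (simp add: linear_iff)
    ultimately show ?thesis by (simp add: convex_INT convex_linear_vimage)
  qed
  have absb: "absorbing U"
    unfolding absorbing_def
  proof
    fix \<phi> :: "'a top_dual"
    define m where "m = (\<Sum>x\<in>F. \<bar>dual_apply \<phi> x\<bar>)"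
    have m: "\<bar>dual_apply \<phi> x\<bar> < 1 + m" if "x \<in> F" for x
      using member_le_sum[OF that, of "\<lambda>x. \<bar>dual_apply \<phi> x\<bar>"] F(1) by (simp add: m_def)
    have "m \<ge> 0" by (simp add: m_def sum_nonneg)
    then have "(e / (1 + m)) *\<^sub>R \<phi> \<in> U" "e / (1 + m) > 0"
      using mult_strict_left_mono[OF m F(2)] F(2) by (auto simp: U_def abs_mult field_simps)
    then show "\<exists>t>0. t *\<^sub>R \<phi> \<in> U" by blast
  qed
  have disj: "(\<xi> + \<phi>, \<sigma> + r) \<notin> E" if "\<phi> \<in> U" "\<bar>r\<bar> < d" for \<phi> r
  proof -
    have "\<xi> + \<phi> \<in> A" using that by (intro F(3)) (simp add: U_def)
    moreover have "\<sigma> + r \<in> B" using that d by (auto simp: dist_real_def)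
    ultimately show ?thesis using AB(4) closure_subset[of E] by blast
  qed
  obtain \<Psi> c where \<Psi>: "linear \<Psi>" "\<forall>\<phi>\<in>U. \<Psi> \<phi> \<le> 1"
    "\<forall>\<phi> r. (\<phi>, r) \<in> E \<longrightarrow> \<Psi> \<xi> + c * \<sigma> + 1 \<le> \<Psi> \<phi> + c * r"
    by (rule separation_from_box[OF conv absb d(1) E disj])
  have "\<Psi> \<phi> = 0" if \<phi>: "\<forall>x\<in>F. dual_apply \<phi> x = 0" for \<phi>
  proof -
    have "k * \<Psi> \<phi> \<le> 1" for k
      using \<Psi>(2)[rule_format, of "k *\<^sub>R \<phi>"] \<phi> F(2) linear_scale[OF \<Psi>(1), of k \<phi>] by (simp add: U_def)
    from this[of "2 / \<Psi> \<phi>"] show ?thesis by (simp split: if_splits)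
  qed
  then obtain x where x: "\<And>\<phi>. \<Psi> \<phi> = dual_apply \<phi> x"
    using functional_is_evaluation[OF F(1) \<Psi>(1)] by blast
  show thesis
  proof (rule that[of "- x" c]; intro allI impI)
    fix \<phi> r assume "(\<phi>, r) \<in> E"
    from \<Psi>(3)[rule_format, OF this]
    show "dual_apply \<phi> (- x) - c * r + 1 \<le> dual_apply \<xi> (- x) - c * \<sigma>"
      by (simp add: x linear_neg[OF dual_apply_linear])
  qed
qed

section \<open>Consequences of a convex system\<close>

text \<open>The affine functions that are nonpositive at \<open>a\<close> form a convex cone, and it contains each generator:
\<open>\<theta> - t \<le> h\<close> and \<open>h a \<le> 0\<close> for \<open>h = \<delta>\<^sub>C\<close> and for each constraint.\<close>

lemma char_cone_valid:
  assumes a: "a \<in> solution_set C I g" and p: "(\<phi>, r) \<in> char_cone C I g"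
  shows "dual_apply \<phi> a \<le> r"
proof -
  let ?H = "{p. dual_apply (fst p) a \<le> snd p}"
  have gen: "epi (conjugate h) \<subseteq> ?H" if h: "h a \<le> 0" for h
  proof clarsimp
    fix \<theta> t assume "(\<theta>, t) \<in> epi (conjugate h)"
    then have "ereal (dual_apply \<theta> a - t) \<le> h a" by (simp add: mem_epi_conjugate)
    then have "ereal (dual_apply \<theta> a - t) \<le> 0" using h by (rule order_trans)
    then show "dual_apply \<theta> a \<le> t" by simp
  qed
  have "epi (conjugate (indicator_fun C)) \<subseteq> ?H"
    using a by (intro gen) (simp add: solution_set_def indicator_fun_def)
  moreover have "(\<Union>i\<in>I. epi (conjugate (g i))) \<subseteq> ?H"
    using a by (intro UN_least gen) (simp add: solution_set_def)
  moreover have "convex_cone ?H"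
    unfolding convex_cone_iff by (auto intro: add_mono mult_left_mono)
  ultimately have "char_cone C I g \<subseteq> ?H"
    unfolding char_cone_def by (intro hull_minimal) simp_all
  with p show ?thesis by auto
qed

theorem theorem4p1:
  fixes C :: "'a::locally_convex_space set"
    and I :: "'i set"
    and g :: "'i \<Rightarrow> 'a \<Rightarrow> ereal"
    and f :: "'a \<Rightarrow> ereal"
    and xs :: "'a top_dual"
    and s :: real
  assumes "C \<noteq> {}" and "closed C" and "convex C"
    and "\<And>i. i \<in> I \<Longrightarrow> g i \<in> Gamma_fun"
    and "f \<in> Gamma_fun"
    and "solution_set C I g \<inter> edom f \<noteq> {}"
  shows "(\<forall>x\<in>C. (\<forall>i\<in>I. g i x \<le> 0) \<longrightarrow> f x - ereal (dual_apply xs x) \<ge> ereal s)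
    \<longleftrightarrow> (xs, - s) \<in> closure (epi (conjugate f) + char_cone C I g)"
proof -
  define K where "K = char_cone C I g"
  define E where "E = epi (conjugate f) + K"
  have sol: "x \<in> solution_set C I g \<longleftrightarrow> x \<in> C \<and> (\<forall>i\<in>I. g i x \<le> 0)" for x
    by (simp add: solution_set_def)
  have E_valid: "dual_apply \<phi> a - r \<le> c"
    if a: "a \<in> solution_set C I g" "f a = ereal c" and E: "(\<phi>, r) \<in> E" for a c \<phi> r
  proof -
    obtain \<theta> q \<kappa> t where *: "(\<theta>, q) \<in> epi (conjugate f)" "(\<kappa>, t) \<in> K" "\<phi> = \<theta> + \<kappa>" "r = q + t"
      using E by (auto simp: E_def set_plus_def)
    have "ereal (dual_apply \<theta> a - q) \<le> ereal c"
      using *(1) a(2) by (metis mem_epi_conjugate)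
    then show ?thesis using char_cone_valid[OF a(1), of \<kappa> t] * by (simp add: K_def)
  qed
  have "ereal s \<le> f a - ereal (dual_apply xs a)"
    if a: "a \<in> solution_set C I g" and xs: "(xs, - s) \<in> closure E" for a
  proof (cases "f a")
    case (real c)
    have "closed {p :: 'a top_dual \<times> real. dual_apply (fst p) a - snd p \<le> c}"
      by (intro closed_Collect_le continuous_intros
          continuous_on_compose2[OF continuous_on_evaluation]) auto
    moreover have "E \<subseteq> {p. dual_apply (fst p) a - snd p \<le> c}" using E_valid[OF a real] by auto
    ultimately have "closure E \<subseteq> {p. dual_apply (fst p) a - snd p \<le> c}" by (rule closure_minimal[rotated])
    then show ?thesis using xs real by auto
  next
    case MInf
    then show ?thesis using assms(5) by (auto simp: Gamma_fun_def proper_fun_def)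
  qed simp
  moreover have "\<exists>x. x \<in> solution_set C I g \<and> f x < ereal (dual_apply xs x + s)"
    if out: "(xs, - s) \<notin> closure E"
  proof -
    have K0: "0 \<in> K" by (simp add: K_def char_cone_def convex_cone_hull_contains_0)
    have gen: "epi (conjugate (indicator_fun C)) \<subseteq> K" "\<And>i. i \<in> I \<Longrightarrow> epi (conjugate (g i)) \<subseteq> K"
      unfolding K_def char_cone_def by (auto intro!: hull_inc)
    have f_sub: "epi (conjugate f) \<subseteq> E" using set_plus_intro[OF _ K0] by (fastforce simp: E_def)
    have "convex E"
      unfolding E_def K_def char_cone_def
      by (intro convex_set_plus convex_epi_conjugate convex_convex_cone_hull)
    obtain \<theta> q where \<theta>: "(\<theta>, q) \<in> epi (conjugate f)" using epi_conjugate_nonempty[OF assms(5)] by auto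
    then have "E \<noteq> {}" using f_sub by auto
    obtain x b where
      sep: "\<forall>\<phi> r. (\<phi>, r) \<in> E \<longrightarrow> dual_apply \<phi> x - b * r + 1 \<le> dual_apply xs x - b * (- s)"
      by (rule weak_star_separation[OF \<open>convex E\<close> \<open>E \<noteq> {}\<close> out])
    have "b \<ge> 0"
    proof (rule nonneg_slope)
      fix r assume "r \<ge> q"
      then have "ereal (dual_apply \<theta> y - r) \<le> f y" for y
        using \<theta> unfolding mem_epi_conjugate by (meson diff_left_mono ereal_less_eq(3) order_trans)
      then have "(\<theta>, r) \<in> E" using f_sub by (auto simp: mem_epi_conjugate)
      from sep[rule_format, OF this] show "dual_apply \<theta> x - b * r \<le> dual_apply xs x + b * s - 1" by simp
    qed
    obtain a c where a: "a \<in> solution_set C I g" "f a = ereal c"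
    proof -
      obtain a where "a \<in> solution_set C I g" "f a < \<infinity>" using assms(6) by (auto simp: edom_def)
      moreover have "f a \<noteq> - \<infinity>" using assms(5) by (auto simp: Gamma_fun_def proper_fun_def)
      ultimately show thesis using that by (cases "f a") auto
    qed
    obtain \<epsilon> where \<epsilon>: "\<epsilon> > 0" "\<epsilon> * (c - dual_apply xs a - s) < 1" by (rule small_multiple)
    \<comment> \<open>Add \<open>\<epsilon>\<close> times the inequality \<open>\<phi> a - r \<le> c\<close> to the separation and divide by the
      coefficient \<open>k > 0\<close> of \<open>r\<close>: the separation becomes nonvertical, and its point is \<open>z\<close>.\<close>
    define k where "k = b + \<epsilon>"
    define z where "z = inverse k *\<^sub>R (x + \<epsilon> *\<^sub>R a)"
    define m where "m = (dual_apply xs x + b * s - 1 + \<epsilon> * c) / k"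
    have k: "k > 0" using \<open>b \<ge> 0\<close> \<epsilon>(1) by (simp add: k_def)
    have mk: "m * k = dual_apply xs x + b * s - 1 + \<epsilon> * c" using k by (simp add: m_def)
    have z: "dual_apply \<phi> z = (dual_apply \<phi> x + \<epsilon> * dual_apply \<phi> a) / k" for \<phi>
      by (simp add: z_def inverse_eq_divide)
    have E_le: "dual_apply \<phi> z - r \<le> m" if \<phi>: "(\<phi>, r) \<in> E" for \<phi> r
    proof -
      have "\<epsilon> * (dual_apply \<phi> a - r) \<le> \<epsilon> * c"
        using E_valid[OF a \<phi>] \<epsilon>(1) by (intro mult_left_mono) auto
      then have "dual_apply \<phi> x + \<epsilon> * dual_apply \<phi> a \<le> m * k + r * k"
        unfolding mk using sep[rule_format, OF \<phi>] by (simp add: k_def algebra_simps)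
      then show ?thesis using k by (simp add: z pos_divide_le_eq distrib_right diff_le_eq)
    qed
    have m: "m < dual_apply xs z + s"
    proof -
      have "m * k < dual_apply xs x + \<epsilon> * dual_apply xs a + s * k"
        unfolding mk using \<epsilon>(2) by (simp add: k_def algebra_simps)
      then have "m < (dual_apply xs x + \<epsilon> * dual_apply xs a + s * k) / k"
        using k by (simp add: pos_less_divide_eq)
      then show ?thesis using k by (simp add: z add_divide_distrib)
    qed
    have K_le: "dual_apply \<kappa> z - r \<le> 0" if \<kappa>: "(\<kappa>, r) \<in> K" for \<kappa> r
    proof (rule ccontr)
      assume "\<not> dual_apply \<kappa> z - r \<le> 0"
      then have pos: "dual_apply \<kappa> z - r > 0" by simp
      \<comment> \<open>A positive value on the cone could be scaled beyond the bound \<open>m\<close>.\<close>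
      define t where "t = (\<bar>m - (dual_apply \<theta> z - q)\<bar> + 1) / (dual_apply \<kappa> z - r)"
      have "t \<ge> 0" using pos by (simp add: t_def)
      then have "t *\<^sub>R (\<kappa>, r) \<in> K"
        using \<kappa> by (simp only: K_def char_cone_def convex_cone_hull_mul)
      then have "(\<theta>, q) + t *\<^sub>R (\<kappa>, r) \<in> E" unfolding E_def using \<theta> by (rule set_plus_intro[rotated])
      then have "dual_apply \<theta> z - q + t * (dual_apply \<kappa> z - r) \<le> m"
        using E_le[of "\<theta> + t *\<^sub>R \<kappa>" "q + t * r"] by (simp add: algebra_simps)
      moreover have "t * (dual_apply \<kappa> z - r) = \<bar>m - (dual_apply \<theta> z - q)\<bar> + 1"
        using pos by (simp add: t_def)
      ultimately show False by linarith
    qed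
    have "indicator_fun C z \<le> ereal 0"
      using K_le gen(1) by (intro fenchel_moreau indicator_fun_Gamma assms) auto
    then have "z \<in> C" by (auto simp: indicator_fun_def split: if_splits)
    moreover have "g i z \<le> 0" if "i \<in> I" for i
      using fenchel_moreau[OF assms(4)[OF that], of z 0] K_le gen(2)[OF that] by (auto simp: zero_ereal_def)
    moreover have "f z \<le> ereal m" using E_le f_sub by (intro fenchel_moreau[OF assms(5)]) auto
    ultimately show ?thesis using m by (intro exI[of _ z]) (auto simp: sol intro: le_less_trans)
  qed
  moreover have "\<not> ereal s \<le> f x - ereal (dual_apply xs x)"
    if "f x < ereal (dual_apply xs x + s)" for x
    using that by (cases "f x") auto
  ultimately have "(\<forall>x\<in>solution_set C I g. ereal s \<le> f x - ereal (dual_apply xs x))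
      \<longleftrightarrow> (xs, - s) \<in> closure E"
    by blast
  then show ?thesis by (simp add: sol Ball_def E_def K_def imp_conjL)
qed

end
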